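(* Let $D\subseteq \mathbf{Dom}^m$ be a dataset and let $\mathcal{F}=\{F_1,\ldots,F_K\}$ be a set of projections on $D$ such that there exist $F_i,F_j\in\mathcal{F}$, $i\neq j$, with $|\rho_{F_i,F_j}|\ge \frac12$. Then there exist a nonempty subset $I\subseteq\{1,\ldots,K\}$ and a projection $F=\sum_{k\in I}\beta_k F_k$, where $\beta_k\in\mathbb{R}$, such that: (1) for all $k\in I$, $\sigma(F(D))<\sigma(F_k(D))$; (2) for all $k\in I$, $\phi_F$ is stronger than $\phi_{F_k}$ on the subset $$H=\{t \mid (\forall k\in I:\ \beta_k\,\Delta F_k(t)\ge 0)\ \vee\ (\forall k\in I:\ \beta_k\,\Delta F_k(t)\le 0)\};$$ (3) for all $k\notin I$, $|\rho_{F,F_k}|<\frac12$.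
   Context: $\mathbf{Dom}^m=\mathrm{Dom}_1\times\cdots\times\mathrm{Dom}_m$ is the set of all possible tuples over $m$ attributes; tuples $t$ range over $\mathbf{Dom}^m$, and a dataset $D$ is a subset of $\mathbf{Dom}^m$ with $|D|$ tuples. A projection is a function $F:\mathbf{Dom}^m\to\mathbb{R}$; only projections that are linear combinations of the numerical attributes are considered. $F(D)$ is the sequence of values $F(t)$, $t\in D$; $\mu(F(D))$ and $\sigma(F(D))$ are its mean and standard deviation. For a tuple $t$, $\Delta F(t)=F(t)-\mu(F(D))$. For projections $F_1,F_2$, the correlation coefficient over $D$ is $$\rho_{F_1,F_2}=\frac{\frac1{|D|}\sum_{t\in D}\Delta F_1(t)\,\Delta F_2(t)}{\sigma(F_1(D))\,\sigma(F_2(D))}.$$ For a projection $F$, $\phi_F$ denotes the constraint $\mathrm{lb}\le F(\vec A)\le \mathrm{ub}$ (where $\vec A$ is the tuple of attributes) with $\mathrm{lb}=\mu(F(D))-C\,\sigma(F(D))$ and $\mathrm{ub}=\mu(F(D))+C\,\sigma(F(D))$, where $C$ is a fixed positive constant. Its violation at a tuple $t$ is $$[\![\phi_F]\!](t)=\eta\big(\alpha\cdot\max(0,\ F(t)-\mathrm{ub},\ \mathrm{lb}-F(t))\big),\qquad \eta(z)=1-e^{-z},$$ where $\alpha=1/\sigma(F(D))$, and $\alpha$ is set to a large positive number when $\sigma(F(D))=0$. A constraint $\phi_1$ is stronger than $\phi_2$ on a subset $H\subseteq\mathbf{Dom}^m$ if $[\![\phi_1]\!](t)\ge[\![\phi_2]\!](t)$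 for all $t\in H$. *)

theory Defs
  imports Complex_Main "HOL-Library.FuncSet"
begin

text \<open>Attributes are indexed by \<open>1..m\<close>, and attribute \<open>i\<close> has the domain \<open>Dom i\<close>. It is numerical
  when all values in its domain are real numbers; other attributes may hold values of an arbitrary
  type \<open>'c\<close>.\<close>

datatype 'c attr_value = Numeric (real_of: real) | Categorical 'c

type_synonym 'c tuple = "nat \<Rightarrow> 'c attr_value"

definition tuples :: "nat \<Rightarrow> (nat \<Rightarrow> 'c attr_value set) \<Rightarrow> 'c tuple set" where
  "tuples m Dom = (\<Pi>\<^sub>E i\<in>{1..m}. Dom i)"

definition numerical_attrs :: "nat \<Rightarrow> (nat \<Rightarrow> 'c attr_value set) \<Rightarrow> nat set" where
  "numerical_attrs m Dom = {i\<in>{1..m}. Dom i \<subseteq> range Numeric}"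

definition is_projection ::
    "nat \<Rightarrow> (nat \<Rightarrow> 'c attr_value set) \<Rightarrow> ('c tuple \<Rightarrow> real) \<Rightarrow> bool" where
  "is_projection m Dom F \<longleftrightarrow>
     (\<exists>w :: nat \<Rightarrow> real. \<forall>t\<in>tuples m Dom. F t = (\<Sum>i\<in>numerical_attrs m Dom. w i * real_of (t i)))"

definition mean :: "'t set \<Rightarrow> ('t \<Rightarrow> real) \<Rightarrow> real" where
  "mean D F = (\<Sum>t\<in>D. F t) / real (card D)"

definition dev :: "'t set \<Rightarrow> ('t \<Rightarrow> real) \<Rightarrow> 't \<Rightarrow> real" where
  "dev D F t = F t - mean D F"

text \<open>The population standard deviation, which matches the factor \<open>1 / |D|\<close> in the correlation
  coefficient.\<close>

definition sd :: "'t set \<Rightarrow> ('t \<Rightarrow> real) \<Rightarrow> real" where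
  "sd D F = sqrt ((\<Sum>t\<in>D. (dev D F t)\<^sup>2) / real (card D))"

text \<open>When one of the two standard deviations is zero, the quotient is undefined on paper; here
  division by zero makes it \<open>0\<close>, so a projection that is constant on \<open>D\<close> is uncorrelated
  with every projection.\<close>

definition corr :: "'t set \<Rightarrow> ('t \<Rightarrow> real) \<Rightarrow> ('t \<Rightarrow> real) \<Rightarrow> real" where
  "corr D F G = (1 / real (card D) * (\<Sum>t\<in>D. dev D F t * dev D G t)) / (sd D F * sd D G)"

text \<open>The bounded-projection constraint \<open>lb \<le> F(t) \<le> ub\<close>, together with the scaling factor
  \<open>\<alpha>\<close> used to measure its violation.\<close>

record 't bounded_constraint =
  projection :: "'t \<Rightarrow> real"
  lb :: real
  ub :: real
  scaling :: real

text \<open>\<open>C\<close> is the width of the bounds in standard deviations, and \<open>A\<close> is the (large) positive number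
  that replaces \<open>1 / \<sigma>(F(D))\<close> when the standard deviation is zero.\<close>

definition phi ::
    "'t set \<Rightarrow> real \<Rightarrow> real \<Rightarrow> ('t \<Rightarrow> real) \<Rightarrow> 't bounded_constraint" where
  "phi D C A F =
     \<lparr> projection = F,
       lb = mean D F - C * sd D F,
       ub = mean D F + C * sd D F,
       scaling = (if sd D F = 0 then A else 1 / sd D F) \<rparr>"

definition eta :: "real \<Rightarrow> real" where
  "eta z = 1 - exp (- z)"

definition violation :: "'t bounded_constraint \<Rightarrow> 't \<Rightarrow> real" where
  "violation \<phi> t =
     eta (scaling \<phi> * max 0 (max (projection \<phi> t - ub \<phi>) (lb \<phi> - projection \<phi> t)))"

definition stronger_on ::
    "'t set \<Rightarrow> 't bounded_constraint \<Rightarrow> 't bounded_constraint \<Rightarrow> bool" where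
  "stronger_on H \<phi>\<^sub>1 \<phi>\<^sub>2 \<longleftrightarrow> (\<forall>t\<in>H. violation \<phi>\<^sub>1 t \<ge> violation \<phi>\<^sub>2 t)"

end

theory Submission
  imports Defs
begin

text \<open>Start from a single nonconstant projection and, as long as some \<open>F\<^sub>k\<close> with \<open>k \<notin> I\<close> satisfies
  \<open>\<bar>\<rho>\<bar> \<ge> 1/2\<close> with the current \<open>F\<close>, add \<open>\<plusminus>\<sigma>(F) / \<sigma>(F\<^sub>k) \<cdot> F\<^sub>k\<close> to \<open>F\<close>, with the sign opposite to \<open>\<rho>\<close>.
  The deviation of \<open>F\<close> does not grow, so \<open>\<sigma>(F) \<le> \<bar>\<beta>\<^sub>k\<bar> \<sigma>(F\<^sub>k)\<close> remains true for all \<open>k \<in> I\<close>.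
  On \<open>H\<close> the terms \<open>\<beta>\<^sub>k \<Delta>F\<^sub>k\<close> do not cancel, so \<open>\<bar>\<beta>\<^sub>k \<Delta>F\<^sub>k\<bar> \<le> \<bar>\<Delta>F\<bar>\<close>, and this invariant yields (2).
  All of this is invariant under scaling of \<open>F\<close>. Hence \<open>F\<close> can be scaled down to obtain (1) if
  \<open>\<sigma>(F) > 0\<close>, and scaled up to compensate for a small replacement value of \<open>1 / \<sigma>(F)\<close> if \<open>\<sigma>(F) = 0\<close>.\<close>

section \<open>Linearity of deviations; scaling of standard deviation and correlation\<close>

lemma dev_sum:
  "dev D (\<lambda>t. \<Sum>k\<in>I. \<beta> k * Fs k t) t = (\<Sum>k\<in>I. \<beta> k * dev D (Fs k) t)"
proof -
  have "(\<Sum>t\<in>D. \<Sum>k\<in>I. \<beta> k * Fs k t) = (\<Sum>k\<in>I. \<beta> k * (\<Sum>t\<in>D. Fs k t))"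
    by (subst sum.swap) (simp add: sum_distrib_left)
  then have "mean D (\<lambda>t. \<Sum>k\<in>I. \<beta> k * Fs k t) = (\<Sum>k\<in>I. \<beta> k * mean D (Fs k))"
    by (simp add: mean_def sum_divide_distrib[of _ I])
  then show ?thesis
    by (simp add: dev_def sum_subtractf right_diff_distrib)
qed

lemma dev_add_cmult: "dev D (\<lambda>t. F t + c * G t) t = dev D F t + c * dev D G t"
  by (simp add: dev_def mean_def sum.distrib sum_distrib_left[symmetric] add_divide_distrib
      right_diff_distrib)

lemma dev_cmult: "dev D (\<lambda>t. c * F t) t = c * dev D F t"
  by (simp add: dev_def mean_def sum_distrib_left[symmetric] right_diff_distrib)

lemma sd_nonneg: "sd D F \<ge> 0"
  by (simp add: sd_def sum_nonneg)

lemma sd_power2: "(sd D F)\<^sup>2 = (\<Sum>t\<in>D. (dev D F t)\<^sup>2) / real (card D)"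
  by (simp add: sd_def sum_nonneg)

lemma sd_cmult: "sd D (\<lambda>t. c * F t) = \<bar>c\<bar> * sd D F"
proof -
  have "(\<Sum>t\<in>D. (dev D (\<lambda>t. c * F t) t)\<^sup>2) / real (card D) =
      c\<^sup>2 * ((\<Sum>t\<in>D. (dev D F t)\<^sup>2) / real (card D))"
    by (simp add: dev_cmult power_mult_distrib sum_distrib_left)
  then show ?thesis
    unfolding sd_def by (simp only: real_sqrt_mult real_sqrt_abs)
qed

lemma corr_cmult:
  assumes "c > 0"
  shows "corr D (\<lambda>t. c * F t) G = corr D F G"
proof -
  have "(\<Sum>t\<in>D. c * dev D F t * dev D G t) = c * (\<Sum>t\<in>D. dev D F t * dev D G t)"
    by (simp add: sum_distrib_left mult.assoc)
  then show ?thesis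
    using assms by (simp add: corr_def dev_cmult sd_cmult)
qed

text \<open>A vanishing standard deviation makes the denominator of \<open>corr\<close> zero, and
  division by zero returns \<open>0\<close>. So a correlation of absolute value at least 1/2
  supplies the positive standard deviations used as divisors below.\<close>

lemma corr_nonzero_sd_pos:
  assumes "corr D F G \<noteq> 0"
  shows "sd D F > 0" "sd D G > 0"
proof -
  have "sd D F \<noteq> 0" "sd D G \<noteq> 0"
    using assms by (auto simp: corr_def)
  then show "sd D F > 0" "sd D G > 0"
    using sd_nonneg[of D F] sd_nonneg[of D G] by linarith+
qed

section \<open>Cancellation between correlated projections\<close>

lemma sd_add_cmult_power2:
  "(sd D (\<lambda>t. F t + c * G t))\<^sup>2 =
     (sd D F)\<^sup>2 + 2 * c * ((1 / real (card D)) * (\<Sum>t\<in>D. dev D F t * dev D G t)) + c\<^sup>2 * (sd D G)\<^sup>2"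
proof -
  have "(\<Sum>t\<in>D. (dev D F t + c * dev D G t)\<^sup>2) =
     (\<Sum>t\<in>D. (dev D F t)\<^sup>2) + 2 * c * (\<Sum>t\<in>D. dev D F t * dev D G t) + c\<^sup>2 * (\<Sum>t\<in>D. (dev D G t)\<^sup>2)"
    by (simp add: power2_sum power_mult_distrib sum.distrib sum_distrib_left algebra_simps)
  then show ?thesis
    by (simp add: sd_power2 dev_add_cmult add_divide_distrib)
qed

text \<open>If \<open>c * G\<close> has the same standard deviation as \<open>F\<close> and covaries
  negatively with it, the sum has variance
  \<open>(2 - 2 * \<bar>r\<bar>) * (sd D F)\<^sup>2\<close>, where \<open>r\<close> is the
  correlation of \<open>F\<close> and \<open>G\<close>. The threshold 1/2 is exactly what makes the
  factor at most 1.\<close>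

lemma correlated_cancellation:
  assumes "\<bar>corr D F G\<bar> \<ge> 1 / 2"
  obtains c where "\<bar>c\<bar> * sd D G = sd D F" "sd D (\<lambda>t. F t + c * G t) \<le> sd D F"
proof -
  define r where "r = corr D F G"
  define c where "c = - sgn r * (sd D F / sd D G)"
  have r: "\<bar>r\<bar> \<ge> 1 / 2" using assms by (simp add: r_def)
  have pos: "sd D F > 0" "sd D G > 0"
    using corr_nonzero_sd_pos[of D F G] assms by auto
  have cov: "1 / real (card D) * (\<Sum>t\<in>D. dev D F t * dev D G t) = r * (sd D F * sd D G)"
    using pos by (simp add: r_def corr_def)
  have abs: "\<bar>c\<bar> * sd D G = sd D F"
    using pos r by (auto simp: c_def abs_mult abs_sgn_eq)
  have cr: "c * (r * (sd D F * sd D G)) = - (\<bar>r\<bar> * (sd D F)\<^sup>2)"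
    using pos by (simp add: c_def power2_eq_square abs_sgn mult.commute mult.left_commute)
  have c2: "c\<^sup>2 * (sd D G)\<^sup>2 = (sd D F)\<^sup>2"
    by (metis abs power2_abs power_mult_distrib)
  have "(sd D (\<lambda>t. F t + c * G t))\<^sup>2 = (2 - 2 * \<bar>r\<bar>) * (sd D F)\<^sup>2"
    unfolding sd_add_cmult_power2 cov c2 using cr by (simp add: algebra_simps)
  also have "\<dots> \<le> 1 * (sd D F)\<^sup>2"
    using r by (intro mult_right_mono) auto
  finally have "sd D (\<lambda>t. F t + c * G t) \<le> sd D F"
    using sd_nonneg by (auto intro: power2_le_imp_le)
  with abs that show ?thesis by blast
qed

text \<open>The greedy enlargement becomes a maximality argument: among the index sets that admit
  coefficients with the invariant, take one of largest cardinality. A correlated index outside it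
  could be added, a contradiction. Nonzero coefficients are recorded because the later rescaling
  divides by them.\<close>

lemma uncorrelated_combination_exists:
  fixes Fs :: "'k \<Rightarrow> 't \<Rightarrow> real"
  assumes "finite S" "i \<in> S" "sd D (Fs i) > 0"
  obtains I \<beta> where "I \<noteq> {}" "I \<subseteq> S"
    "\<And>k. k \<in> I \<Longrightarrow> sd D (Fs k) > 0 \<and> \<beta> k \<noteq> 0"
    "\<And>k. k \<in> I \<Longrightarrow> sd D (\<lambda>t. \<Sum>l\<in>I. \<beta> l * Fs l t) \<le> \<bar>\<beta> k\<bar> * sd D (Fs k)"
    "\<And>k. k \<in> S - I \<Longrightarrow> \<bar>corr D (\<lambda>t. \<Sum>l\<in>I. \<beta> l * Fs l t) (Fs k)\<bar> < 1 / 2"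
proof -
  define inv where "inv I \<beta> \<longleftrightarrow> I \<noteq> {} \<and> I \<subseteq> S \<and> (\<forall>k\<in>I. sd D (Fs k) > 0 \<and> \<beta> k \<noteq> 0 \<and>
     sd D (\<lambda>t. \<Sum>l\<in>I. \<beta> l * Fs l t) \<le> \<bar>\<beta> k\<bar> * sd D (Fs k))" for I and \<beta> :: "'k \<Rightarrow> real"
  define P where "P I \<longleftrightarrow> (\<exists>\<beta>. inv I \<beta>)" for I
  \<comment> \<open>For a single projection with coefficient 1 the deviation bound is an
    equality.\<close>
  have "inv {i} (\<lambda>_. 1)"
    using assms by (simp add: inv_def)
  then have "P {i}" unfolding P_def by blast
  moreover have "\<forall>I. P I \<longrightarrow> card I < Suc (card S)"
    using assms(1) by (metis P_def inv_def card_mono less_Suc_eq_le)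
  ultimately obtain I where I: "P I" and maxI: "\<And>J. P J \<Longrightarrow> card J \<le> card I"
    using ex_has_greatest_nat[of P "{i}" card] by blast
  then obtain \<beta> where inv: "inv I \<beta>" by (auto simp: P_def)
  let ?F = "\<lambda>t. \<Sum>l\<in>I. \<beta> l * Fs l t"
  have fin: "finite I" using inv assms(1) finite_subset by (auto simp: inv_def)
  have "\<bar>corr D ?F (Fs k)\<bar> < 1 / 2" if k: "k \<in> S - I" for k
  proof (rule ccontr)
    assume "\<not> ?thesis"
    then have ge: "\<bar>corr D ?F (Fs k)\<bar> \<ge> 1 / 2" by simp
    then have pos: "sd D ?F > 0" "sd D (Fs k) > 0"
      using corr_nonzero_sd_pos[of D ?F "Fs k"] by auto
    obtain c where c: "\<bar>c\<bar> * sd D (Fs k) = sd D ?F" "sd D (\<lambda>t. ?F t + c * Fs k t) \<le> sd D ?F"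
      using correlated_cancellation[OF ge] .
    have eq: "(\<Sum>l\<in>insert k I. (\<beta>(k := c)) l * Fs l t) = ?F t + c * Fs k t" for t
    proof -
      have "(\<Sum>l\<in>I. (\<beta>(k := c)) l * Fs l t) = ?F t"
        using k by (intro sum.cong) auto
      then show ?thesis using k fin by simp
    qed
    have "inv (insert k I) (\<beta>(k := c))"
      unfolding inv_def eq
    proof (intro conjI ballI)
      fix l assume l: "l \<in> insert k I"
      \<comment> \<open>Both cases bound the deviation of the old \<open>?F\<close>: by the choice
        of \<open>c\<close> for the new index, by the invariant for the others. As the new term does
        not increase the deviation, the bounds pass to the enlarged sum.\<close>
      have "sd D (Fs l) > 0 \<and> (\<beta>(k := c)) l \<noteq> 0 \<and> sd D ?F \<le> \<bar>(\<beta>(k := c)) l\<bar> * sd D (Fs l)"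
      proof (cases "l = k")
        case True
        have "c \<noteq> 0" using c(1) pos(1) by auto
        then show ?thesis using True c(1) pos(2) by simp
      next
        case False
        then show ?thesis using l inv by (simp add: inv_def)
      qed
      then show "sd D (Fs l) > 0" "(\<beta>(k := c)) l \<noteq> 0"
        "sd D (\<lambda>t. ?F t + c * Fs k t) \<le> \<bar>(\<beta>(k := c)) l\<bar> * sd D (Fs l)"
        using c(2) by linarith+
    qed (use inv k in \<open>auto simp: inv_def\<close>)
    then have "P (insert k I)" unfolding P_def by blast
    from maxI[OF this] show False using k fin by simp
  qed
  with inv show ?thesis by (intro that[of I \<beta>]) (auto simp: inv_def)
qed

section \<open>Comparison of violations\<close>

lemma abs_le_abs_sum_same_sign:
  fixes f :: "'k \<Rightarrow> real"
  assumes "finite I" "k \<in> I" "(\<forall>l\<in>I. f l \<ge> 0) \<or> (\<forall>l\<in>I. f l \<le> 0)"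
  shows "\<bar>f k\<bar> \<le> \<bar>\<Sum>l\<in>I. f l\<bar>"
proof -
  have "\<bar>f k\<bar> \<le> (\<Sum>l\<in>I. \<bar>f l\<bar>)"
    using assms(1,2) by (intro member_le_sum) auto
  \<comment> \<open>Terms of a common sign turn the triangle inequality into an equality.\<close>
  also have "\<dots> = \<bar>\<Sum>l\<in>I. f l\<bar>"
    using assms(3)
  proof
    assume "\<forall>l\<in>I. f l \<ge> 0"
    then show ?thesis by (simp add: sum_nonneg)
  next
    assume "\<forall>l\<in>I. f l \<le> 0"
    then show ?thesis by (simp add: sum_nonpos sum_negf)
  qed
  finally show ?thesis .
qed

text \<open>The bounds are symmetric around the mean, so the two one-sided excesses merge into the
  excess of \<open>\<bar>dev D F t\<bar>\<close> over \<open>C * sd D F\<close>. If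
  \<open>sd D F = 0\<close>, the interval shrinks to the mean.\<close>

lemma violation_phi:
  "violation (phi D C A F) t =
     eta (if sd D F = 0 then A * \<bar>dev D F t\<bar> else max 0 (\<bar>dev D F t\<bar> / sd D F - C))"
    if "A > 0"
proof -
  have m: "max 0 (max (F t - (mean D F + C * sd D F)) (mean D F - C * sd D F - F t)) =
      max 0 (\<bar>dev D F t\<bar> - C * sd D F)"
    by (auto simp: dev_def max_def abs_if)
  show ?thesis
  proof (cases "sd D F = 0")
    case True
    then show ?thesis using m by (simp add: violation_def phi_def)
  next
    case False
    then have "sd D F > 0" using sd_nonneg[of D F] by simp
    then have "1 / sd D F * max 0 (\<bar>dev D F t\<bar> - C * sd D F) = max 0 (\<bar>dev D F t\<bar> / sd D F - C)"
      by (auto simp: max_def field_simps)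
    then show ?thesis using False m by (simp add: violation_def phi_def)
  qed
qed

text \<open>Since \<open>eta\<close> is increasing, it suffices to compare standardized deviations.
  If \<open>sd D F = 0\<close>, the factor \<open>A\<close> replaces the quotient for
  \<open>F\<close>, and subtracting \<open>C\<close> on the side of \<open>G\<close> only
  helps.\<close>

lemma violation_phi_mono:
  assumes "A > 0" "C > 0" "sd D G > 0"
    and pos: "sd D F > 0 \<Longrightarrow> \<bar>dev D G t\<bar> / sd D G \<le> \<bar>dev D F t\<bar> / sd D F"
    and zero: "sd D F = 0 \<Longrightarrow> \<bar>dev D G t\<bar> / sd D G \<le> A * \<bar>dev D F t\<bar>"
  shows "violation (phi D C A G) t \<le> violation (phi D C A F) t"
proof -
  have mono: "eta x \<le> eta y" if "x \<le> y" for x y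
    using that by (simp add: eta_def)
  show ?thesis
  proof (cases "sd D F = 0")
    case True
    have "max 0 (\<bar>dev D G t\<bar> / sd D G - C) \<le> A * \<bar>dev D F t\<bar>"
      using zero[OF True] assms(1,2) by simp
    then show ?thesis using assms(1,3) True by (simp add: violation_phi mono)
  next
    case False
    then have "sd D F > 0" using sd_nonneg[of D F] by simp
    then have "max 0 (\<bar>dev D G t\<bar> / sd D G - C) \<le> max 0 (\<bar>dev D F t\<bar> / sd D F - C)"
      using pos by (simp add: max_def)
    then show ?thesis using assms(1,3) False by (simp add: violation_phi mono)
  qed
qed

section \<open>Linear combinations as projections, and their rescaling\<close>

lemma is_projection_sum:
  assumes "\<And>k. k \<in> I \<Longrightarrow> is_projection m Dom (Fs k)"
  shows "is_projection m Dom (\<lambda>t. \<Sum>k\<in>I. \<beta> k * Fs k t)"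
proof -
  have "\<forall>k\<in>I. \<exists>w. \<forall>t\<in>tuples m Dom. Fs k t = (\<Sum>i\<in>numerical_attrs m Dom. w i * real_of (t i))"
    using assms by (simp add: is_projection_def)
  then obtain w where w: "\<And>k t. k \<in> I \<Longrightarrow> t \<in> tuples m Dom \<Longrightarrow>
      Fs k t = (\<Sum>i\<in>numerical_attrs m Dom. w k i * real_of (t i))"
    by metis
  have "(\<Sum>k\<in>I. \<beta> k * Fs k t) =
      (\<Sum>i\<in>numerical_attrs m Dom. (\<Sum>k\<in>I. \<beta> k * w k i) * real_of (t i))"
    if "t \<in> tuples m Dom" for t
  proof -
    have "(\<Sum>k\<in>I. \<beta> k * Fs k t) =
        (\<Sum>k\<in>I. \<Sum>i\<in>numerical_attrs m Dom. \<beta> k * w k i * real_of (t i))"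
      using w that by (simp add: sum_distrib_left mult.assoc)
    also have "\<dots> = (\<Sum>i\<in>numerical_attrs m Dom. (\<Sum>k\<in>I. \<beta> k * w k i) * real_of (t i))"
      by (subst sum.swap) (simp add: sum_distrib_right)
    finally show ?thesis .
  qed
  then show ?thesis unfolding is_projection_def
    by (intro exI[of _ "\<lambda>i. \<Sum>k\<in>I. \<beta> k * w k i"]) simp
qed

text \<open>The two demands on \<open>c\<close> never compete: for \<open>s > 0\<close> only a small
  \<open>c\<close> is required, while for \<open>s = 0\<close> the strict bound holds for every
  \<open>c\<close> and only a large \<open>c\<close> matters.\<close>

lemma scaling_factor_exists:
  fixes s A :: real
  assumes "finite I" "s \<ge> 0" "A > 0"
    and "\<And>k. k \<in> I \<Longrightarrow> \<sigma> k > 0" "\<And>k. k \<in> I \<Longrightarrow> b k > 0"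
  obtains c where "c > 0" "\<And>k. k \<in> I \<Longrightarrow> c * s < \<sigma> k"
    "\<And>k. s = 0 \<Longrightarrow> k \<in> I \<Longrightarrow> 1 \<le> c * A * b k"
proof (cases "s = 0")
  case True
  \<comment> \<open>The inserted \<open>1\<close> makes the maximum defined and positive even for
    empty \<open>I\<close>.\<close>
  define c where "c = Max (insert 1 ((\<lambda>k. 1 / (A * b k)) ` I))"
  have "c \<ge> 1" using assms(1) by (simp add: c_def)
  moreover have "1 \<le> c * A * b k" if "k \<in> I" for k
  proof -
    have "1 / (A * b k) \<le> c" unfolding c_def using assms(1) that by (intro Max_ge) auto
    then show ?thesis using assms(3) assms(5)[OF that] by (simp add: field_simps)
  qed
  ultimately show ?thesis using True assms(4) by (intro that[of c]) auto
next
  case False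
  then have s: "s > 0" using assms(2) by simp
  define u where "u = Min (insert 1 (\<sigma> ` I))"
  have u: "u > 0" using assms(1,4) by (simp add: u_def)
  have "u / 2 < \<sigma> k" if "k \<in> I" for k
  proof -
    have "u \<le> \<sigma> k" unfolding u_def using assms(1) that by (intro Min_le) auto
    then show ?thesis using u by simp
  qed
  \<comment> \<open>The witness gives \<open>c * s = u / 2\<close>, strictly below every
    \<open>\<sigma> k\<close>.\<close>
  then show ?thesis using s u by (intro that[of "u / (2 * s)"]) auto
qed

theorem theorem12:
  fixes m K :: nat
    and Dom :: "nat \<Rightarrow> 'c attr_value set"
    and D :: "'c tuple set"
    and Fs :: "nat \<Rightarrow> 'c tuple \<Rightarrow> real"
    and C A :: real
  assumes "finite D" and "D \<subseteq> tuples m Dom"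
    and "0 < C" and "0 < A"
    and "\<And>k. k \<in> {1..K} \<Longrightarrow> is_projection m Dom (Fs k)"
    and "\<exists>i\<in>{1..K}. \<exists>j\<in>{1..K}. i \<noteq> j \<and> \<bar>corr D (Fs i) (Fs j)\<bar> \<ge> 1 / 2"
  shows "\<exists>(I :: nat set) (\<beta> :: nat \<Rightarrow> real) (F :: 'c tuple \<Rightarrow> real).
           I \<noteq> {} \<and> I \<subseteq> {1..K} \<and>
           is_projection m Dom F \<and>
           F = (\<lambda>t. \<Sum>k\<in>I. \<beta> k * Fs k t) \<and>
           (\<forall>k\<in>I. sd D F < sd D (Fs k)) \<and>
           (\<forall>k\<in>I. stronger_on
              {t \<in> tuples m Dom. (\<forall>l\<in>I. \<beta> l * dev D (Fs l) t \<ge> 0) \<or>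
                                 (\<forall>l\<in>I. \<beta> l * dev D (Fs l) t \<le> 0)}
              (phi D C A F) (phi D C A (Fs k))) \<and>
           (\<forall>k\<in>{1..K} - I. \<bar>corr D F (Fs k)\<bar> < 1 / 2)"
proof -
  from assms(6) obtain i j where ij: "i \<in> {1..K}" "\<bar>corr D (Fs i) (Fs j)\<bar> \<ge> 1 / 2"
    by blast
  then have "sd D (Fs i) > 0"
    using corr_nonzero_sd_pos(1)[of D "Fs i" "Fs j"] by auto
  with ij(1) obtain I \<gamma> where I: "I \<noteq> {}" "I \<subseteq> {1..K}"
    and nz: "\<And>k. k \<in> I \<Longrightarrow> sd D (Fs k) > 0 \<and> \<gamma> k \<noteq> 0"
    and le: "\<And>k. k \<in> I \<Longrightarrow> sd D (\<lambda>t. \<Sum>l\<in>I. \<gamma> l * Fs l t) \<le> \<bar>\<gamma> k\<bar> * sd D (Fs k)"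
    and uncorr: "\<And>k. k \<in> {1..K} - I \<Longrightarrow> \<bar>corr D (\<lambda>t. \<Sum>l\<in>I. \<gamma> l * Fs l t) (Fs k)\<bar> < 1 / 2"
    using uncorrelated_combination_exists[of "{1..K}" i D Fs] by blast
  define G where "G = (\<lambda>t. \<Sum>l\<in>I. \<gamma> l * Fs l t)"
  have fin: "finite I" using I(2) finite_subset by blast
  obtain c where c: "c > 0" and small: "\<And>k. k \<in> I \<Longrightarrow> c * sd D G < sd D (Fs k)"
    and large: "\<And>k. sd D G = 0 \<Longrightarrow> k \<in> I \<Longrightarrow> 1 \<le> c * A * (\<bar>\<gamma> k\<bar> * sd D (Fs k))"
    using scaling_factor_exists[of I "sd D G" A "\<lambda>k. sd D (Fs k)" "\<lambda>k. \<bar>\<gamma> k\<bar> * sd D (Fs k)"]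
      fin sd_nonneg assms(4) nz by (metis mult_pos_pos zero_less_abs_iff)
  define \<beta> where "\<beta> k = c * \<gamma> k" for k
  define F where "F = (\<lambda>t. \<Sum>k\<in>I. \<beta> k * Fs k t)"
  have FG: "F = (\<lambda>t. c * G t)"
    by (simp add: F_def G_def \<beta>_def sum_distrib_left mult.assoc)
  have sdF: "sd D F = c * sd D G" using c by (simp add: FG sd_cmult)
  have "violation (phi D C A (Fs k)) t \<le> violation (phi D C A F) t"
    if k: "k \<in> I" and t: "(\<forall>l\<in>I. \<beta> l * dev D (Fs l) t \<ge> 0) \<or> (\<forall>l\<in>I. \<beta> l * dev D (Fs l) t \<le> 0)"
    for k t
  proof -
    have "\<bar>\<beta> k * dev D (Fs k) t\<bar> \<le> \<bar>dev D F t\<bar>"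
      unfolding F_def dev_sum by (rule abs_le_abs_sum_same_sign[OF fin k t])
    then have dom: "\<bar>\<beta> k\<bar> * \<bar>dev D (Fs k) t\<bar> \<le> \<bar>dev D F t\<bar>"
      by (simp add: abs_mult)
    have sk: "sd D (Fs k) > 0" using nz k by blast
    have abs\<beta>: "\<bar>\<beta> k\<bar> = c * \<bar>\<gamma> k\<bar>" using c by (simp add: \<beta>_def abs_mult)
    show ?thesis
    proof (rule violation_phi_mono[OF assms(4,3) sk])
      assume F: "sd D F > 0"
      \<comment> \<open>Multiplying this bound with \<open>dom\<close> eliminates the coefficient
        \<open>\<bar>\<beta> k\<bar>\<close> and leaves the standardized deviations.\<close>
      have "sd D F \<le> \<bar>\<beta> k\<bar> * sd D (Fs k)"
        using mult_left_mono[OF le[OF k], of c] c by (simp add: sdF abs\<beta> G_def mult.assoc)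
      then have "\<bar>dev D (Fs k) t\<bar> * sd D F \<le> \<bar>dev D (Fs k) t\<bar> * (\<bar>\<beta> k\<bar> * sd D (Fs k))"
        by (intro mult_left_mono) auto
      also have "\<dots> \<le> \<bar>dev D F t\<bar> * sd D (Fs k)"
        using mult_right_mono[OF dom, of "sd D (Fs k)"] sk by (simp add: mult_ac)
      finally show "\<bar>dev D (Fs k) t\<bar> / sd D (Fs k) \<le> \<bar>dev D F t\<bar> / sd D F"
        using F sk by (simp add: field_simps)
    next
      assume "sd D F = 0"
      \<comment> \<open>Since \<open>c > 0\<close>, also \<open>sd D G = 0\<close>, the case in
        which \<open>c\<close> was chosen large.\<close>
      then have "1 \<le> A * \<bar>\<beta> k\<bar> * sd D (Fs k)"
        using large[OF _ k] c by (simp add: sdF abs\<beta> mult_ac)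
      then have "\<bar>dev D (Fs k) t\<bar> * 1 \<le> \<bar>dev D (Fs k) t\<bar> * (A * \<bar>\<beta> k\<bar> * sd D (Fs k))"
        by (intro mult_left_mono) auto
      also have "\<dots> \<le> A * \<bar>dev D F t\<bar> * sd D (Fs k)"
        using mult_left_mono[OF dom, of "A * sd D (Fs k)"] sk assms(4) by (simp add: mult_ac)
      finally show "\<bar>dev D (Fs k) t\<bar> / sd D (Fs k) \<le> A * \<bar>dev D F t\<bar>"
        using sk by (simp add: field_simps)
    qed
  qed
  then have "\<forall>k\<in>I. stronger_on
      {t \<in> tuples m Dom. (\<forall>l\<in>I. \<beta> l * dev D (Fs l) t \<ge> 0) \<or> (\<forall>l\<in>I. \<beta> l * dev D (Fs l) t \<le> 0)}
      (phi D C A F) (phi D C A (Fs k))"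
    unfolding stronger_on_def by blast
  moreover have "is_projection m Dom F"
    unfolding F_def using assms(5) I(2) by (intro is_projection_sum) blast
  moreover have "\<forall>k\<in>I. sd D F < sd D (Fs k)"
    using small by (simp add: sdF)
  moreover have "\<forall>k\<in>{1..K} - I. \<bar>corr D F (Fs k)\<bar> < 1 / 2"
    using uncorr c unfolding FG by (simp add: corr_cmult G_def)
  ultimately show ?thesis
    using I F_def by (intro exI[of _ I] exI[of _ \<beta>] exI[of _ F]) (intro conjI)
qed

end
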